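(* Let $s\in(0,1)$, let $\Omega\subset\mathbb{R}^n$ be a smooth bounded domain and let $\mathcal I_{\rm sym}$ be a translation invariant, positively $1$-homogeneous nonlocal operator elliptic with respect to $\mathcal{K}_{\rm sym}$ (see context). Let $u$ be a positive viscosity solution to $$-\mathcal I_{\rm sym}u+1_{(1,2)}(2s)\,H(\nabla u)=\frac{k(x)}{u^\delta}\ \text{ in }\Omega,\qquad u>0\ \text{ in }\Omega,\qquad u=0\ \text{ in }\Omega^c,$$ for some $\delta>0$, where $k\in C(\bar\Omega)$, $k>0$ in $\bar\Omega$, and $H:\mathbb{R}^n\to\mathbb{R}$ is positively $1$-homogeneous and locally Lipschitz. Let $\psi$ be the solution to the torsion problem $$-\mathcal I_{\rm sym}\psi+1_{(1,2)}(2s)\,H(\nabla\psi)=1\ \text{ in }\Omega,\qquad \psi>0\ \text{ in }\Omega,\qquad \psi=0\ \text{ in }\Omega^c,$$ and suppose that for some $0<\beta<\min\{1,2s\}$ and some constant $C$ we have $$(\mathrm{dist}(x,\Omega^c))^\beta\leq C\psi(x)\quad\text{in }\Omega.$$ If $\beta(1+\delta)>2s$, then there is a constant $C_1$ with $$(\mathrm{dist}(x,\Omega^c))^\beta\leq C_1u(x)\ \text{ in }\Omega,\qquad\text{and}\qquad \sup_{x\in\Omega}\frac{u(x)}{(\mathrm{dist}(x,\Omega^c))^\beta}=\infty.$$ In particular, $u\notin C^\beta(\bar\Omega)$.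
   Context: $1_{(1,2)}(2s)$ equals $1$ if $2s\in(1,2)$ and $0$ otherwise; $\Omega^c=\mathbb{R}^n\setminus\Omega$. Fix $s\in(0,1)$ and $0<\lambda\leq\Lambda$. $\mathcal{K}_{\rm sym}=\mathcal{K}_{\rm sym}(\lambda,\Lambda)$ is the family of measurable kernels $K:\mathbb{R}^n\setminus\{0\}\to[0,\infty)$ with $\frac{\lambda}{|z|^{n+2s}}\leq K(z)\leq\frac{\Lambda}{|z|^{n+2s}}$ and $K(z)=K(-z)$ for $z\neq0$. With $B$ the unit ball centered at $0$, put $$L_Ku(x)=\int_{\mathbb{R}^n}\big[u(x+z)-u(x)-1_{\{2s\in[1,2)\}}1_B(z)\nabla u(x)\cdot z\big]K(z)\,dz .$$ Let $\omega_s(z)=(1+|z|)^{-n-2s}$, and let $L^1(\omega_s)$ be the functions integrable against $\omega_s$. $\mathcal I_{\rm sym}$ is a nonlocal operator which is translation invariant ($\mathcal I_{\rm sym}u_h(x)=\mathcal I_{\rm sym}u(x+h)$ for all $x,h$, where $u_h=u(\cdot+h)$), positively $1$-homogeneous, and elliptic with respect to $\mathcal{K}_{\rm sym}$, i.e. $$\inf_{K\in\mathcal{K}_{\rm sym}}(L_Ku(x)-L_Kv(x))\leq\mathcal I_{\rm sym}u(x)-\mathcal I_{\rm sym}v(x)\leq\sup_{K\in\mathcal{K}_{\rm sym}}(L_Ku(x)-L_Kv(x))$$ whenever $u,v\in C^{1,1}(x)\cap L^1(\omega_s)$ (where $C^{1,1}(x)$ means $C^{1,1}$ at the point $x$). Solutions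 are viscosity solutions: consider $-\mathcal I_{\rm sym}u+G(x,u,\nabla u)=0$ in $\Omega$, with $G$ continuous. A measurable $u\in L^1(\omega_s)$, upper (resp. lower) semicontinuous in $\bar\Omega$, is a viscosity subsolution (resp. supersolution) if for each $x_0\in\Omega$ and $\varphi\in C^2(B_r(x_0))$, for some $r>0$, with $u(x_0)=\varphi(x_0)$ and $u\leq\varphi$ (resp. $u\geq\varphi$) in $B_r(x_0)$, one has $-\mathcal I_{\rm sym}v(x_0)+G(x_0,u(x_0),\nabla\varphi(x_0))\leq0$ (resp. $\geq0$), where $v=\varphi$ in $B_r(x_0)$ and $v=u$ elsewhere. A viscosity solution is both a sub- and a supersolution. *)

theory Defs
  imports "HOL-Analysis.Analysis"
begin

section \<open>Gradient and classical regularity\<close>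

definition grad :: "(real^'n \<Rightarrow> real) \<Rightarrow> real^'n \<Rightarrow> real^'n" where
  "grad f x = (THE p. GDERIV f x :> p)"

lemma grad_eqI: "GDERIV f x :> p \<Longrightarrow> grad f x = p"
proof -
  assume p: "GDERIV f x :> p"
  have "q = p" if q: "GDERIV f x :> q" for q
  proof -
    have "(\<lambda>h. h \<bullet> q) = (\<lambda>h. h \<bullet> p)"
      using has_derivative_unique p q unfolding gderiv_def by blast
    then show ?thesis
      by (metis vector_eq_ldot)
  qed
  with p show ?thesis
    unfolding grad_def by (rule the_equality)
qed

text \<open>Membership in \<open>C\<^sup>k(S)\<close>, meant for open \<open>S\<close>.\<close>

primrec Ck_on :: "nat \<Rightarrow> (real^'n) set \<Rightarrow> (real^'n \<Rightarrow> real) \<Rightarrow> bool" where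
  "Ck_on 0 S f \<longleftrightarrow> continuous_on S f"
| "Ck_on (Suc k) S f \<longleftrightarrow>
     (\<forall>x\<in>S. f differentiable (at x)) \<and> (\<forall>i. Ck_on k S (\<lambda>x. grad f x $ i))"

text \<open>
  Pointwise \<open>C^{1,1}\<close> regularity at \<open>x\<close>: a first order expansion with quadratic error near \<open>x\<close>.
  The vector \<open>p\<close> is then necessarily the gradient at \<open>x\<close>.
\<close>

definition C11_at :: "(real^'n \<Rightarrow> real) \<Rightarrow> real^'n \<Rightarrow> bool" where
  "C11_at u x \<longleftrightarrow>
     (\<exists>p M r. r > 0 \<and> (\<forall>z\<in>ball 0 r. \<bar>u (x + z) - u x - p \<bullet> z\<bar> \<le> M * (norm z)\<^sup>2))"

definition upper_semicontinuous_on :: "'a::topological_space set \<Rightarrow> ('a \<Rightarrow> real) \<Rightarrow> bool" where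
  "upper_semicontinuous_on S u \<longleftrightarrow>
     (\<forall>x\<in>S. \<forall>c>u x. eventually (\<lambda>y. u y < c) (at x within S))"

definition lower_semicontinuous_on :: "'a::topological_space set \<Rightarrow> ('a \<Rightarrow> real) \<Rightarrow> bool" where
  "lower_semicontinuous_on S u \<longleftrightarrow>
     (\<forall>x\<in>S. \<forall>c<u x. eventually (\<lambda>y. c < u y) (at x within S))"

text \<open>The space \<open>C\<^sup>\<beta>(S)\<close> for an exponent \<open>\<beta>\<close> in \<open>(0,1)\<close>.\<close>

definition holder_on :: "real \<Rightarrow> 'a::metric_space set \<Rightarrow> ('a \<Rightarrow> real) \<Rightarrow> bool" where
  "holder_on \<beta> S u \<longleftrightarrow>
     bounded (u ` S) \<and> (\<exists>M. \<forall>x\<in>S. \<forall>y\<in>S. \<bar>u x - u y\<bar> \<le> M * dist x y powr \<beta>)"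

definition locally_lipschitz :: "('a::metric_space \<Rightarrow> 'b::metric_space) \<Rightarrow> bool" where
  "locally_lipschitz f \<longleftrightarrow> (\<forall>x. \<exists>r>0. \<exists>L. L-lipschitz_on (ball x r) f)"

definition pos_homogeneous1 :: "('a::real_vector \<Rightarrow> real) \<Rightarrow> bool" where
  "pos_homogeneous1 H \<longleftrightarrow> (\<forall>t>0. \<forall>p. H (t *\<^sub>R p) = t * H p)"

text \<open>
  Near each boundary point, in suitable orthonormal coordinates, the domain is the region above
  the graph of a smooth function of \<open>n - 1\<close> variables.  The direction \<open>e\<close> is the last coordinate
  axis, and the \<open>n - 1\<close> variables are encoded as the projection of \<open>x\<close> orthogonal to \<open>e\<close>.
\<close>

definition smooth_bounded_domain :: "(real^'n) set \<Rightarrow> bool" where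
  "smooth_bounded_domain \<Omega> \<longleftrightarrow>
     open \<Omega> \<and> connected \<Omega> \<and> \<Omega> \<noteq> {} \<and> bounded \<Omega> \<and>
     (\<forall>x0\<in>frontier \<Omega>. \<exists>r>0. \<exists>e \<gamma>. norm e = 1 \<and> (\<forall>k. Ck_on k UNIV \<gamma>) \<and>
        \<Omega> \<inter> ball x0 r = {x \<in> ball x0 r. x \<bullet> e > \<gamma> (x - (x \<bullet> e) *\<^sub>R e)})"

section \<open>Nonlocal operators\<close>

text \<open>
  Kernels live on the punctured space; the value of the total function at \<open>0\<close> is irrelevant
  because \<open>{0}\<close> is a null set.
\<close>

definition Ksym :: "real \<Rightarrow> real \<Rightarrow> real \<Rightarrow> (real^'n \<Rightarrow> real) set" where
  "Ksym s lam Lam =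
     {K \<in> borel_measurable lebesgue. \<forall>z. z \<noteq> 0 \<longrightarrow>
        lam / norm z powr (real CARD('n) + 2 * s) \<le> K z \<and>
        K z \<le> Lam / norm z powr (real CARD('n) + 2 * s) \<and>
        K z = K (- z)}"

definition LK :: "real \<Rightarrow> (real^'n \<Rightarrow> real) \<Rightarrow> (real^'n \<Rightarrow> real) \<Rightarrow> real^'n \<Rightarrow> real" where
  "LK s K u x =
     (LINT z|lebesgue.
        (u (x + z) - u x
          - indicat_real {1..<2} (2 * s) * indicat_real (ball 0 1) z * (grad u x \<bullet> z)) * K z)"

definition omega_s :: "real \<Rightarrow> real^'n \<Rightarrow> real" where
  "omega_s s z = (1 + norm z) powr (- real CARD('n) - 2 * s)"

definition L1_omega :: "real \<Rightarrow> (real^'n \<Rightarrow> real) set" where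
  "L1_omega s = {u. integrable lebesgue (\<lambda>z. u z * omega_s s z)}"

text \<open>
  An operator is a total map on functions, but \<open>I u x\<close> is meaningful only when
  \<open>u \<in> L1_omega s\<close> and \<open>C11_at u x\<close>; the structural conditions are imposed only there.
\<close>

definition translation_invariant ::
    "real \<Rightarrow> ((real^'n \<Rightarrow> real) \<Rightarrow> real^'n \<Rightarrow> real) \<Rightarrow> bool" where
  "translation_invariant s I \<longleftrightarrow>
     (\<forall>u x h. u \<in> L1_omega s \<and> C11_at u (x + h) \<longrightarrow> I (\<lambda>y. u (y + h)) x = I u (x + h))"

definition operator_pos_homogeneous1 ::
    "real \<Rightarrow> ((real^'n \<Rightarrow> real) \<Rightarrow> real^'n \<Rightarrow> real) \<Rightarrow> bool" where
  "operator_pos_homogeneous1 s I \<longleftrightarrow>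
     (\<forall>u x t. u \<in> L1_omega s \<and> C11_at u x \<and> t > 0 \<longrightarrow> I (\<lambda>y. t * u y) x = t * I u x)"

text \<open>
  On the stated domain the integrals defining \<open>LK s K u x\<close> converge absolutely, and uniformly
  in \<open>K\<close>, so the real-valued infimum and supremum range over bounded sets.
\<close>

definition elliptic_Ksym ::
    "real \<Rightarrow> real \<Rightarrow> real \<Rightarrow> ((real^'n \<Rightarrow> real) \<Rightarrow> real^'n \<Rightarrow> real) \<Rightarrow> bool" where
  "elliptic_Ksym s lam Lam I \<longleftrightarrow>
     (\<forall>u v x. u \<in> L1_omega s \<and> v \<in> L1_omega s \<and> C11_at u x \<and> C11_at v x \<longrightarrow>
        (INF K\<in>Ksym s lam Lam. LK s K u x - LK s K v x) \<le> I u x - I v x \<and>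
        I u x - I v x \<le> (SUP K\<in>Ksym s lam Lam. LK s K u x - LK s K v x))"

section \<open>Viscosity solutions of \<open>- I u + G(x, u, \<nabla>u) = 0\<close>\<close>

definition glue :: "real^'n \<Rightarrow> real \<Rightarrow> (real^'n \<Rightarrow> real) \<Rightarrow> (real^'n \<Rightarrow> real) \<Rightarrow> real^'n \<Rightarrow> real" where
  "glue x0 r \<phi> u = (\<lambda>x. if x \<in> ball x0 r then \<phi> x else u x)"

text \<open>
  A test function that is \<open>C\<^sup>2\<close> in the open ball may fail to be integrable near the sphere, and then
  \<open>I\<close> is not defined at the glued function.  Membership of the glued function in \<open>L1_omega s\<close>
  is therefore part of being a test function.
\<close>

definition viscosity_subsolution ::
    "real \<Rightarrow> ((real^'n \<Rightarrow> real) \<Rightarrow> real^'n \<Rightarrow> real) \<Rightarrow> (real^'n) set \<Rightarrow>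
     (real^'n \<Rightarrow> real \<Rightarrow> real^'n \<Rightarrow> real) \<Rightarrow> (real^'n \<Rightarrow> real) \<Rightarrow> bool" where
  "viscosity_subsolution s I \<Omega> G u \<longleftrightarrow>
     u \<in> L1_omega s \<and> upper_semicontinuous_on (closure \<Omega>) u \<and>
     (\<forall>x0\<in>\<Omega>. \<forall>r>0. \<forall>\<phi>.
        Ck_on 2 (ball x0 r) \<phi> \<and> u x0 = \<phi> x0 \<and> (\<forall>x\<in>ball x0 r. u x \<le> \<phi> x) \<and>
        glue x0 r \<phi> u \<in> L1_omega s \<longrightarrow>
        - I (glue x0 r \<phi> u) x0 + G x0 (u x0) (grad \<phi> x0) \<le> 0)"

definition viscosity_supersolution ::
    "real \<Rightarrow> ((real^'n \<Rightarrow> real) \<Rightarrow> real^'n \<Rightarrow> real) \<Rightarrow> (real^'n) set \<Rightarrow>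
     (real^'n \<Rightarrow> real \<Rightarrow> real^'n \<Rightarrow> real) \<Rightarrow> (real^'n \<Rightarrow> real) \<Rightarrow> bool" where
  "viscosity_supersolution s I \<Omega> G u \<longleftrightarrow>
     u \<in> L1_omega s \<and> lower_semicontinuous_on (closure \<Omega>) u \<and>
     (\<forall>x0\<in>\<Omega>. \<forall>r>0. \<forall>\<phi>.
        Ck_on 2 (ball x0 r) \<phi> \<and> u x0 = \<phi> x0 \<and> (\<forall>x\<in>ball x0 r. u x \<ge> \<phi> x) \<and>
        glue x0 r \<phi> u \<in> L1_omega s \<longrightarrow>
        - I (glue x0 r \<phi> u) x0 + G x0 (u x0) (grad \<phi> x0) \<ge> 0)"

definition viscosity_solution ::
    "real \<Rightarrow> ((real^'n \<Rightarrow> real) \<Rightarrow> real^'n \<Rightarrow> real) \<Rightarrow> (real^'n) set \<Rightarrow>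
     (real^'n \<Rightarrow> real \<Rightarrow> real^'n \<Rightarrow> real) \<Rightarrow> (real^'n \<Rightarrow> real) \<Rightarrow> bool" where
  "viscosity_solution s I \<Omega> G u \<longleftrightarrow>
     viscosity_subsolution s I \<Omega> G u \<and> viscosity_supersolution s I \<Omega> G u"

end

theory Submission
  imports Defs
begin

text \<open>
  All three claims follow from a lower growth bound \<open>u \<ge> c d\<^sup>\<gamma>\<close> with \<open>\<gamma> < \<beta>\<close>, where \<open>d\<close> is the
  distance to the complement.

  To obtain it, fix \<open>x\<close>, take \<open>\<rho>\<close> comparable to \<open>d(x)\<close> and \<open>A = 2 u(x)\<close>, and slide the
  paraboloid \<open>A (1 - |y - x|\<^sup>2 / \<rho>\<^sup>2)\<close> from below until it touches \<open>u\<close> at a point \<open>y0\<close> of the ball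
  \<open>B\<^sub>\<rho>(x)\<close>.  There \<open>u(y0) < A\<close>, while operator and Hamiltonian together are at most
  \<open>C A \<rho>\<^sup>-\<^sup>a\<close> for any \<open>a > 2s\<close> close to \<open>2s\<close>, so the equation gives
  \<open>min k / A\<^sup>\<delta> \<le> C A \<rho>\<^sup>-\<^sup>a\<close>, that is \<open>u(x) \<ge> c d(x)\<^sup>\<gamma>\<close> with \<open>\<gamma> = a / (1 + \<delta>)\<close>.  Since
  \<open>\<beta> (1 + \<delta>) > 2s\<close>, there is room for \<open>\<gamma> < \<beta>\<close>.  Taking \<open>a\<close> strictly larger than \<open>2s\<close> avoids the
  logarithm that the gradient term would produce at \<open>2s = 1\<close>.
\<close>

section \<open>Integrability of powers of the norm by dyadic decomposition\<close>

text \<open>Wherever \<open>f\<close> is nonzero, a single term of the series of functions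
  \<open>c k * indicator (ball 0 (r k))\<close> dominates it, and that series integrates to the unit
  ball volume times the given sum. This replaces polar coordinates in the two lemmas that
  follow.\<close>

lemma integrable_ball_cover:
  fixes f :: "real^'n \<Rightarrow> real" and c r :: "nat \<Rightarrow> real"
  assumes f: "f \<in> borel_measurable lebesgue" "\<And>z. 0 \<le> f z"
    and c: "\<And>k. 0 \<le> c k" and r: "\<And>k. 0 \<le> r k"
    and sm: "summable (\<lambda>k. c k * r k ^ CARD('n))"
    and cover: "\<And>z. f z \<noteq> 0 \<Longrightarrow> \<exists>k. z \<in> ball 0 (r k) \<and> f z \<le> c k"
  shows "integrable lebesgue f"
proof (rule integrableI_nonneg)
  let ?g = "\<lambda>k (z::real^'n). ennreal (c k) * indicator (ball 0 (r k)) z"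
  let ?V = "unit_ball_vol (real CARD('n))"
  have term_le: "g k \<le> suminf g" for g :: "nat \<Rightarrow> ennreal" and k
    using sum_le_suminf[OF summableI, of "{k}" g] by simp
  have le: "ennreal (f z) \<le> (\<Sum>k. ?g k z)" for z
  proof (cases "f z = 0")
    case False
    then obtain k where k: "z \<in> ball 0 (r k)" "f z \<le> c k"
      using cover by blast
    then have "ennreal (f z) \<le> ?g k z"
      by (simp add: ennreal_leI)
    also have "\<dots> \<le> (\<Sum>k. ?g k z)"
      by (rule term_le)
    finally show ?thesis .
  qed simp
  have "(\<integral>\<^sup>+ z. f z \<partial>lebesgue) \<le> (\<integral>\<^sup>+ z. (\<Sum>k. ?g k z) \<partial>lebesgue)"
    by (intro nn_integral_mono le)
  also have "\<dots> = (\<Sum>k. (\<integral>\<^sup>+ z. ?g k z \<partial>lebesgue))"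
    by (intro nn_integral_suminf borel_measurable_times_ennreal borel_measurable_indicator) auto
  also have "\<dots> = (\<Sum>k. ennreal (?V * (c k * r k ^ CARD('n))))"
    by (intro suminf_cong)
      (simp add: nn_integral_cmult_indicator emeasure_ball r c ennreal_mult[symmetric] mult_ac)
  also have "\<dots> < \<infinity>"
    using summable_mult[OF sm, of ?V] c r
    by (subst suminf_ennreal2) auto
  finally show "(\<integral>\<^sup>+ z. f z \<partial>lebesgue) < \<infinity>" .
qed (use f in auto)

text \<open>On the shell where \<open>norm z\<close> lies between \<open>2 powr (- k - 1)\<close>
  and \<open>2 powr (- k)\<close> the power is at most \<open>c k\<close>, because its exponent is
  nonpositive for \<open>b \<le> CARD('n)\<close>. Multiplied by the ball volumes this gives a
  geometric series of ratio \<open>2 powr (- b)\<close>.\<close>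

lemma integrable_norm_powr_near_0:
  fixes b :: real
  assumes b: "0 < b" "b \<le> CARD('n)"
  shows "integrable lebesgue
    (\<lambda>z::real^'n. indicat_real (ball 0 1) z * norm z powr (b - CARD('n)))"
proof -
  define n where "n = real CARD('n)"
  define c where "c = (\<lambda>k::nat. 2 powr ((real k + 1) * (n - b)))"
  \<comment> \<open>Twice the outer radius of the shell, so that the open ball contains the shell's
    outer sphere.\<close>
  define r where "r = (\<lambda>k::nat. (2::real) powr (1 - real k))"
  have eq: "c k * r k ^ CARD('n) = 2 powr (2 * n - b) * (2 powr (- b)) ^ k" for k
  proof -
    have "r k ^ CARD('n) = 2 powr ((1 - real k) * n)"
      by (simp add: r_def n_def powr_realpow[symmetric] powr_powr)
    moreover have "(2 powr (- b)) ^ k = 2 powr (- b * real k)"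
      by (simp add: powr_realpow[symmetric] powr_powr)
    ultimately show ?thesis
      by (simp add: c_def powr_add[symmetric]) (simp add: algebra_simps)
  qed
  have sm: "summable (\<lambda>k. c k * r k ^ CARD('n))"
    unfolding eq using b
    by (intro summable_mult summable_geometric) (simp add: powr_less_one)
  have meas: "(\<lambda>z::real^'n. indicat_real (ball 0 1) z * norm z powr (b - n)) \<in> borel_measurable lebesgue"
    by (intro measurable_completion borel_measurable_times borel_measurable_indicator
        powr_real_measurable borel_measurable_norm) auto
  show ?thesis
    unfolding n_def[symmetric]
  proof (rule integrable_ball_cover[where c=c and r=r, OF meas _ _ _ sm])
    fix z :: "real^'n"
    assume "indicat_real (ball 0 1) z * norm z powr (b - n) \<noteq> 0"
    then have z: "z \<noteq> 0" "norm z < 1"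
      by (auto simp: indicator_def split: if_splits)
    define L where "L = - log 2 (norm z)"
    have L: "L \<ge> 0" and nz: "norm z = 2 powr (- L)"
      using z by (auto simp: L_def log_le_zero_cancel_iff)
    let ?k = "nat \<lfloor>L\<rfloor>"
    have k: "real ?k \<le> L" "L < real ?k + 1"
      using L by linarith+
    have "norm z < r ?k"
      unfolding nz r_def using k by (intro powr_less_mono) auto
    moreover have "norm z powr (b - n) = 2 powr (L * (n - b))"
      by (simp add: nz powr_powr algebra_simps)
    moreover have "\<dots> \<le> c ?k"
      unfolding c_def using k b by (intro powr_mono mult_right_mono) (auto simp: n_def)
    ultimately show "\<exists>k. z \<in> ball 0 (r k) \<and>
        indicat_real (ball 0 1) z * norm z powr (b - n) \<le> c k"
      using z by (intro exI[of _ ?k]) auto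
  qed (auto simp: c_def r_def)
qed

text \<open>The same decomposition with shells growing outwards; the ratio is now
  \<open>2 powr (n - e)\<close>, less than 1 since \<open>e\<close> exceeds the dimension.\<close>

lemma integrable_norm_powr_away_0:
  fixes e :: real
  assumes e: "e > CARD('n)"
  shows "integrable lebesgue
    (\<lambda>z::real^'n. indicat_real (- ball 0 1) z * norm z powr (- e))"
proof -
  define n where "n = real CARD('n)"
  define c where "c = (\<lambda>k::nat. 2 powr (- (real k * e)))"
  define r where "r = (\<lambda>k::nat. (2::real) powr (real k + 1))"
  have eq: "c k * r k ^ CARD('n) = 2 powr n * (2 powr (n - e)) ^ k" for k
  proof -
    have "r k ^ CARD('n) = 2 powr ((real k + 1) * n)"
      by (simp add: r_def n_def powr_realpow[symmetric] powr_powr)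
    moreover have "(2 powr (n - e)) ^ k = 2 powr ((n - e) * real k)"
      by (simp add: powr_realpow[symmetric] powr_powr)
    ultimately show ?thesis
      by (simp add: c_def powr_add[symmetric]) (simp add: algebra_simps)
  qed
  have sm: "summable (\<lambda>k. c k * r k ^ CARD('n))"
    unfolding eq using e
    by (intro summable_mult summable_geometric) (simp add: powr_less_one n_def)
  have meas: "(\<lambda>z::real^'n. indicat_real (- ball 0 1) z * norm z powr (- e)) \<in> borel_measurable lebesgue"
    by (intro measurable_completion borel_measurable_times borel_measurable_indicator
        powr_real_measurable borel_measurable_norm) auto
  show ?thesis
  proof (rule integrable_ball_cover[where c=c and r=r, OF meas _ _ _ sm])
    fix z :: "real^'n"
    assume "indicat_real (- ball 0 1) z * norm z powr (- e) \<noteq> 0"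
    then have z: "norm z \<ge> 1"
      by (auto simp: indicator_def split: if_splits)
    define L where "L = log 2 (norm z)"
    have "norm z > 0"
      using z by linarith
    then have L: "L \<ge> 0" and nz: "norm z = 2 powr L"
      using z by (auto simp: L_def zero_le_log_cancel_iff)
    let ?k = "nat \<lfloor>L\<rfloor>"
    have k: "real ?k \<le> L" "L < real ?k + 1"
      using L by linarith+
    have "norm z < r ?k"
      unfolding nz r_def using k by (intro powr_less_mono) auto
    moreover have "norm z powr (- e) = 2 powr (- (L * e))"
      by (simp add: nz powr_powr)
    moreover have "\<dots> \<le> c ?k"
      unfolding c_def using k e by (intro powr_mono) (auto intro!: mult_right_mono)
    ultimately show "\<exists>k. z \<in> ball 0 (r k) \<and>
        indicat_real (- ball 0 1) z * norm z powr (- e) \<le> c k"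
      using z by (intro exI[of _ ?k]) auto
  qed (auto simp: c_def r_def)
qed

section \<open>Minima, quadratic test functions and the Hamiltonian\<close>

text \<open>Without a minimizer, each \<open>x\<close> has a strictly better point
  \<open>y x\<close>, and semicontinuity keeps \<open>f\<close> above \<open>f (y x)\<close> on a
  neighbourhood \<open>U x\<close>. Finitely many \<open>U x\<close> cover \<open>S\<close>; the
  best of the corresponding \<open>y x\<close> lies in one of them and is thereby beaten by another
  one.\<close>

lemma lower_semicontinuous_attains_inf:
  assumes S: "compact S" "S \<noteq> {}" and f: "lower_semicontinuous_on S f"
  shows "\<exists>x\<in>S. \<forall>y\<in>S. f x \<le> f y"
proof (rule ccontr)
  assume "\<not> ?thesis"
  then have "\<forall>x\<in>S. \<exists>y\<in>S. f y < f x"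
    by (meson not_le)
  then obtain y where y: "\<And>x. x \<in> S \<Longrightarrow> y x \<in> S" "\<And>x. x \<in> S \<Longrightarrow> f (y x) < f x"
    by metis
  have "\<forall>x\<in>S. \<exists>U. open U \<and> x \<in> U \<and> (\<forall>z\<in>U \<inter> S. f (y x) < f z)"
  proof
    fix x assume x: "x \<in> S"
    then have "eventually (\<lambda>z. f (y x) < f z) (at x within S)"
      using f y unfolding lower_semicontinuous_on_def by blast
    then show "\<exists>U. open U \<and> x \<in> U \<and> (\<forall>z\<in>U \<inter> S. f (y x) < f z)"
      unfolding eventually_at_topological using y(2)[OF x] by (metis IntD1 IntD2)
  qed
  then obtain U where U: "\<And>x. x \<in> S \<Longrightarrow> open (U x)" "\<And>x. x \<in> S \<Longrightarrow> x \<in> U x"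
    "\<And>x z. x \<in> S \<Longrightarrow> z \<in> U x \<inter> S \<Longrightarrow> f (y x) < f z"
    by metis
  obtain D where D: "D \<subseteq> S" "finite D" "S \<subseteq> (\<Union>x\<in>D. U x)"
    using compactE_image[OF S(1), of S U] U by blast
  then have "D \<noteq> {}"
    using S(2) by auto
  then obtain d where d: "d \<in> D" "\<And>x. x \<in> D \<Longrightarrow> f (y d) \<le> f (y x)"
    using ex_min_if_finite[of "(\<lambda>x. f (y x)) ` D"] D(2) by (auto simp: not_less)
  have "y d \<in> S"
    using d(1) D(1) y(1) by blast
  then obtain x where "x \<in> D" "y d \<in> U x"
    using D(3) by blast
  then have "f (y x) < f (y d)"
    using U(3) \<open>y d \<in> S\<close> D(1) by blast
  then show False
    using d(2)[OF \<open>x \<in> D\<close>] by linarith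
qed

lemma GDERIV_quadratic:
  fixes x0 :: "real^'n"
  shows "GDERIV (\<lambda>y. c0 - m * (norm (y - x0))\<^sup>2) y :> - (2 * m) *\<^sub>R (y - x0)"
  unfolding gderiv_def power2_norm_eq_inner
  by (auto intro!: derivative_eq_intros simp: inner_commute algebra_simps)

lemma Ck_on_2_quadratic:
  fixes x0 :: "real^'n"
  shows "Ck_on 2 S (\<lambda>y. c0 - m * (norm (y - x0))\<^sup>2)"
proof -
  have diff: "f differentiable at y" if "GDERIV f y :> p" for f :: "real^'n \<Rightarrow> real" and y p
    using that unfolding gderiv_def differentiable_def by blast
  have g1: "grad (\<lambda>y. c0 - m * (norm (y - x0))\<^sup>2) = (\<lambda>y. - (2 * m) *\<^sub>R (y - x0))"
    using grad_eqI[OF GDERIV_quadratic] by blast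
  have lin: "GDERIV (\<lambda>y. - (2 * m) * (y $ i - x0 $ i)) y :> - (2 * m) *\<^sub>R axis i 1" for i and y :: "real^'n"
    unfolding gderiv_def
    by (auto intro!: derivative_eq_intros bounded_linear.has_derivative[OF bounded_linear_vec_nth]
        simp: inner_axis)
  have g2: "grad (\<lambda>y. - (2 * m) * (y $ i - x0 $ i)) = (\<lambda>y. - (2 * m) *\<^sub>R axis i 1)" for i
    using grad_eqI[OF lin] by blast
  have "(\<lambda>y. (- (2 * m) *\<^sub>R (y - x0)) $ i) = (\<lambda>y. - (2 * m) * (y $ i - x0 $ i))" for i
    by simp
  then have "Ck_on (Suc (Suc 0)) S (\<lambda>y. c0 - m * (norm (y - x0))\<^sup>2)"
    using diff[OF GDERIV_quadratic] diff[OF lin]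
    unfolding Ck_on.simps g1 by (simp only: g2) auto
  then show ?thesis
    by (metis numeral_2_eq_2)
qed

text \<open>Continuity bounds \<open>H\<close> on the compact unit sphere, and homogeneity carries
  the bound to every nonzero vector.\<close>

lemma pos_homogeneous1_bound:
  fixes H :: "real^'n \<Rightarrow> real"
  assumes H: "pos_homogeneous1 H" "locally_lipschitz H"
  shows "\<exists>B\<ge>0. \<forall>p. H p \<le> B * norm p"
proof -
  have "isCont H x" for x
  proof -
    obtain r L where "r > 0" "L-lipschitz_on (ball x r) H"
      using H(2) unfolding locally_lipschitz_def by blast
    then have "continuous_on (ball x r) H"
      by (simp add: lipschitz_on_continuous_on)
    then show ?thesis
      using \<open>r > 0\<close> by (simp add: continuous_on_eq_continuous_at)
  qed
  then have "continuous_on (sphere 0 1) H"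
    by (simp add: continuous_at_imp_continuous_on)
  then have "bounded (H ` sphere 0 1)"
    by (intro compact_imp_bounded compact_continuous_image) auto
  then obtain B where B: "\<And>q. norm q = 1 \<Longrightarrow> \<bar>H q\<bar> \<le> B"
    unfolding bounded_iff by (metis imageI mem_sphere_0 real_norm_def)
  have "H p \<le> \<bar>B\<bar> * norm p" for p
  proof (cases "p = 0")
    case True
    \<comment> \<open>Homogeneity is only assumed for positive factors, so \<open>H 0 = 0\<close>
      comes from the factor 2.\<close>
    have "H (2 *\<^sub>R 0) = 2 * H 0"
      using H(1) unfolding pos_homogeneous1_def by (metis zero_less_numeral)
    then show ?thesis
      using True by simp
  next
    case False
    have "H (norm p *\<^sub>R sgn p) = norm p * H (sgn p)"
      using H(1) False unfolding pos_homogeneous1_def by simp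
    moreover have "norm p *\<^sub>R sgn p = p"
      using False by (simp add: sgn_div_norm)
    ultimately have "H p = norm p * H (sgn p)"
      by simp
    moreover have "H (sgn p) \<le> \<bar>B\<bar>"
      using B[of "sgn p"] False by (simp add: norm_sgn)
    ultimately show ?thesis
      by (metis mult.commute mult_right_mono norm_ge_zero)
  qed
  then show ?thesis
    by (intro exI[of _ "\<bar>B\<bar>"]) auto
qed

section \<open>Lower bounds for the nonlocal operator\<close>

text \<open>For positive \<open>a\<close> this is the minimum of 1 and the \<open>a\<close>-th power
  of the norm; \<open>a = 2\<close> gives the usual weight for Levy measures.\<close>

definition trunc_powr :: "real \<Rightarrow> real^'n \<Rightarrow> real" where
  "trunc_powr a z = (if norm z < 1 then norm z powr a else 1)"

lemma trunc_powr_nonneg: "trunc_powr a z \<ge> 0"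
  by (simp add: trunc_powr_def)

text \<open>Near the origin the quotient has exponent \<open>a - 2 * s - n\<close>, integrable as
  \<open>a > 2 * s\<close>; away from it the kernel decays integrably. The upper bound on
  \<open>a\<close> ensures \<open>a - 2 * s \<le> 1 \<le> n\<close>, as the estimate near the origin
  requires.\<close>

lemma integrable_trunc_powr:
  assumes a: "2 * s < a" "a \<le> 2 * s + 1" and s: "0 < s"
  shows "integrable lebesgue (\<lambda>z::real^'n. trunc_powr a z / norm z powr (real CARD('n) + 2 * s))"
proof -
  have "1 \<le> real CARD('n)"
    using one_le_card_finite[where 'a='n] by linarith
  then have b: "0 < a - 2 * s" "a - 2 * s \<le> real CARD('n)" "real CARD('n) < real CARD('n) + 2 * s"
    using a s by linarith+
  have "integrable lebesgue (\<lambda>z::real^'n.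
      indicat_real (ball 0 1) z * norm z powr ((a - 2 * s) - CARD('n)) +
      indicat_real (- ball 0 1) z * norm z powr (- (CARD('n) + 2 * s)))"
    by (intro Bochner_Integration.integrable_add integrable_norm_powr_near_0
        integrable_norm_powr_away_0 b)
  also have "(\<lambda>z::real^'n.
      indicat_real (ball 0 1) z * norm z powr ((a - 2 * s) - CARD('n)) +
      indicat_real (- ball 0 1) z * norm z powr (- (CARD('n) + 2 * s)))
    = (\<lambda>z. trunc_powr a z / norm z powr (real CARD('n) + 2 * s))"
    by (rule ext)
      (auto simp: trunc_powr_def indicator_def powr_diff[symmetric] powr_minus_divide[symmetric] algebra_simps)
  finally show ?thesis .
qed

text \<open>The \<open>itself\<close> argument fixes the dimension, which the real arguments do not
  determine.\<close>

definition trunc_powr_mass :: "'n::finite itself \<Rightarrow> real \<Rightarrow> real \<Rightarrow> real" where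
  "trunc_powr_mass _ s a =
     (LINT z|lebesgue. trunc_powr a (z :: real^'n) / norm z powr (real CARD('n) + 2 * s))"

lemma trunc_powr_mass_nonneg: "trunc_powr_mass TYPE('n::finite) s a \<ge> 0"
  unfolding trunc_powr_mass_def
  by (intro Bochner_Integration.integral_nonneg divide_nonneg_nonneg trunc_powr_nonneg) auto

text \<open>The pure power kernel with constant \<open>lam\<close> is admissible. Nonemptiness is
  what lets a uniform bound pass to the real-valued infimum over kernels.\<close>

lemma Ksym_nonempty:
  assumes "lam \<le> Lam"
  shows "(Ksym s lam Lam :: (real^'n \<Rightarrow> real) set) \<noteq> {}"
proof -
  have "(\<lambda>z::real^'n. lam / norm z powr (real CARD('n) + 2 * s)) \<in> Ksym s lam Lam"
    unfolding Ksym_def using assms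
    by (auto intro!: divide_right_mono measurable_completion borel_measurable_divide
        powr_real_measurable borel_measurable_norm)
  then show ?thesis
    by blast
qed

text \<open>A non-integrable integrand gives \<open>LK\<close> the junk value \<open>0\<close>, which satisfies the bound too.\<close>

lemma LK_lower_bound:
  fixes v :: "real^'n \<Rightarrow> real"
  assumes K: "K \<in> Ksym s lam Lam" and lam: "0 < lam" "lam \<le> Lam" and D: "D \<ge> 0"
    and a: "0 < s" "2 * s < a" "a \<le> 2 * s + 1"
    and v: "\<And>z. v (x + z) - v x
      - indicat_real {1..<2} (2 * s) * indicat_real (ball 0 1) z * (grad v x \<bullet> z) \<ge> - (D * trunc_powr a z)"
  shows "LK s K v x \<ge> - (D * Lam * trunc_powr_mass TYPE('n) s a)"
proof -
  let ?F = "\<lambda>z. (v (x + z) - v x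
      - indicat_real {1..<2} (2 * s) * indicat_real (ball 0 1) z * (grad v x \<bullet> z)) * K z"
  let ?g = "\<lambda>z::real^'n. D * Lam * (trunc_powr a z / norm z powr (real CARD('n) + 2 * s))"
  have g: "integrable lebesgue ?g"
    by (intro integrable_mult_right integrable_trunc_powr a)
  have Fg: "?F z \<ge> - ?g z" for z
  proof (cases "z = 0")
    \<comment> \<open>The kernel bounds say nothing at the origin. There the increment vanishes, and
      \<open>?g\<close> is 0 by the convention on division by 0.\<close>
    case True
    then show ?thesis
      by simp
  next
    case False
    have K1: "lam / norm z powr (real CARD('n) + 2 * s) \<le> K z"
      and K2: "K z \<le> Lam / norm z powr (real CARD('n) + 2 * s)"
      using K False unfolding Ksym_def by blast+
    have "0 \<le> lam / norm z powr (real CARD('n) + 2 * s)"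
      using lam by simp
    then have K0: "0 \<le> K z"
      using K1 by linarith
    have "- ?g z = - (D * trunc_powr a z * (Lam / norm z powr (real CARD('n) + 2 * s)))"
      by simp
    also have "\<dots> \<le> - (D * trunc_powr a z * K z)"
      using mult_left_mono[OF K2 mult_nonneg_nonneg[OF D trunc_powr_nonneg]]
      by (simp only: neg_le_iff_le)
    also have "\<dots> \<le> ?F z"
      using mult_right_mono[OF v K0] by (simp only: mult_minus_left)
    finally show ?thesis .
  qed
  have int_g: "(LINT z|lebesgue. ?g z) = D * Lam * trunc_powr_mass TYPE('n) s a"
    unfolding trunc_powr_mass_def by (rule integral_mult_right_zero)
  have "(LINT z|lebesgue. ?F z) \<ge> - (LINT z|lebesgue. ?g z)"
  proof (cases "integrable lebesgue ?F")
    case True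
    then show ?thesis
      using integral_mono[OF integrable_minus[OF g] True Fg] by (simp only: integral_minus)
  next
    case False
    have "0 \<le> D * Lam * trunc_powr_mass TYPE('n) s a"
      using D lam by (intro mult_nonneg_nonneg trunc_powr_mass_nonneg) auto
    then show ?thesis
      unfolding int_g not_integrable_integral_eq[OF False] by simp
  qed
  then show ?thesis
    unfolding LK_def int_g .
qed

text \<open>Ellipticity controls only differences, so \<open>v\<close> is compared with the zero
  function, on which both \<open>I\<close> and every \<open>LK\<close> vanish. The kernel-wise lower
  bound then passes to the infimum.\<close>

lemma elliptic_lower_bound:
  fixes v :: "real^'n \<Rightarrow> real"
  assumes I: "operator_pos_homogeneous1 s I" "elliptic_Ksym s lam Lam I"
    and lam: "0 < lam" "lam \<le> Lam" and D: "D \<ge> 0"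
    and a: "0 < s" "2 * s < a" "a \<le> 2 * s + 1"
    and v: "v \<in> L1_omega s" "C11_at v x"
    and low: "\<And>z. v (x + z) - v x
      - indicat_real {1..<2} (2 * s) * indicat_real (ball 0 1) z * (grad v x \<bullet> z) \<ge> - (D * trunc_powr a z)"
  shows "I v x \<ge> - (D * Lam * trunc_powr_mass TYPE('n) s a)"
proof -
  let ?o = "\<lambda>y::real^'n. 0::real"
  have o: "?o \<in> L1_omega s" "C11_at ?o x"
    unfolding L1_omega_def C11_at_def by (auto intro!: exI[of _ "0 :: real^'n"] exI[of _ "1::real"])
  \<comment> \<open>Doubling the zero function leaves it unchanged, which forces
    \<open>I ?o x = 0\<close>.\<close>
  have "I (\<lambda>y. 2 * ?o y) x = 2 * I ?o x"
    using I(1)[unfolded operator_pos_homogeneous1_def, rule_format, of ?o x 2] o by simp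
  then have I0: "I ?o x = 0"
    by simp
  have "grad ?o x = 0"
    by (rule grad_eqI) (rule GDERIV_const)
  then have LK0: "LK s K ?o x = 0" for K
    unfolding LK_def by simp
  have "- (D * Lam * trunc_powr_mass TYPE('n) s a)
      \<le> (INF K\<in>Ksym s lam Lam. LK s K v x - LK s K ?o x)"
    using LK_lower_bound[OF _ lam D a low] Ksym_nonempty[OF lam(2)]
    by (intro cINF_greatest) (auto simp: LK0)
  also have "\<dots> \<le> I v x - I ?o x"
    using I(2) v o unfolding elliptic_Ksym_def by blast
  finally show ?thesis
    by (simp add: I0)
qed

section \<open>The sliding paraboloid\<close>

text \<open>Inside the ball the weighted quadratic is continuous, hence bounded on the closed ball;
  outside, integrability is inherited from \<open>u\<close>.\<close>

lemma glue_quadratic_L1_omega: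
  fixes u :: "real^'n \<Rightarrow> real"
  assumes u: "u \<in> L1_omega s" and s: "0 < s"
  shows "glue y0 r (\<lambda>y. c0 - m * (norm (y - x0))\<^sup>2) u \<in> L1_omega s"
proof -
  let ?q = "\<lambda>y. c0 - m * (norm (y - x0))\<^sup>2"
  have q_cont: "continuous_on UNIV (\<lambda>z. ?q z * omega_s s z)"
    unfolding omega_s_def by (intro continuous_intros) (auto simp: add_nonneg_eq_0_iff)
  have "bounded ((\<lambda>z. ?q z * omega_s s z) ` cball y0 r)"
    by (intro compact_imp_bounded compact_continuous_image continuous_on_subset[OF q_cont]) auto
  then obtain B where "\<forall>y\<in>(\<lambda>z. ?q z * omega_s s z) ` cball y0 r. norm y \<le> B"
    unfolding bounded_iff by blast
  then have B: "\<bar>?q z * omega_s s z\<bar> \<le> B" if "z \<in> cball y0 r" for z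
    using that unfolding real_norm_def by blast
  have "(\<lambda>z. ?q z * omega_s s z) \<in> borel_measurable lebesgue"
    using borel_measurable_continuous_onI[OF q_cont] by (intro measurable_completion) simp
  then have 1: "integrable lebesgue (\<lambda>z. indicator (ball y0 r) z *\<^sub>R (?q z * omega_s s z))"
    using B by (intro integrableI_bounded_set_indicator[where B=B])
      (auto intro!: AE_I2 simp: emeasure_bounded_finite[OF bounded_ball, simplified])
  have 2: "integrable lebesgue (\<lambda>z. indicator (- ball y0 r) z *\<^sub>R (u z * omega_s s z))"
    using u unfolding L1_omega_def by (intro integrable_mult_indicator) auto
  have "(\<lambda>z. glue y0 r ?q u z * omega_s s z) =
      (\<lambda>z. indicator (ball y0 r) z *\<^sub>R (?q z * omega_s s z)
         + indicator (- ball y0 r) z *\<^sub>R (u z * omega_s s z))"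
    by (auto simp: glue_def indicator_def)
  then show ?thesis
    unfolding L1_omega_def using Bochner_Integration.integrable_add[OF 1 2] by simp
qed

text \<open>In the scaled variable \<open>t = norm z / \<rho>\<close> the negative part of the
  increment is at most \<open>A * (t\<^sup>2 + 2 * t)\<close> for \<open>t < 1\<close> and
  \<open>A * (1 + 2 * t)\<close> for \<open>t \<ge> 1\<close>, the term \<open>2 * t\<close>
  occurring only where \<open>p \<bullet> z\<close> has to be estimated. Without gradient correction
  that happens for \<open>t < 1\<close>, so \<open>a \<le> 1\<close> is needed; with it, for
  \<open>t \<ge> 1\<close>, so \<open>a \<ge> 1\<close> is needed. Either way
  \<open>3 * A * t powr a\<close> suffices.\<close>

lemma barrier_integrand_bound:
  fixes p z :: "real^'n" and A c \<rho> a :: real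
  assumes A: "A \<ge> 0" and \<rho>: "0 < \<rho>" "\<rho> \<le> 1" and p: "norm p \<le> 2 * A / \<rho>"
    and c: "c = 0 \<and> 0 < a \<and> a \<le> 1 \<or> c = 1 \<and> 1 \<le> a \<and> a \<le> 2"
    and near: "norm z < \<rho> \<Longrightarrow> w - p \<bullet> z \<ge> - (A / \<rho>\<^sup>2 * (norm z)\<^sup>2)"
    and far: "norm z \<ge> \<rho> \<Longrightarrow> w \<ge> - A"
  shows "w - c * indicat_real (ball 0 1) z * (p \<bullet> z) \<ge> - (3 * A * \<rho> powr (- a) * trunc_powr a z)"
proof -
  define t where "t = norm z / \<rho>"
  have t0: "t \<ge> 0"
    using \<rho> by (simp add: t_def)
  have "\<bar>p \<bullet> z\<bar> \<le> norm p * norm z"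
    by (rule Cauchy_Schwarz_ineq2)
  also have "\<dots> \<le> 2 * A / \<rho> * norm z"
    using p by (rule mult_right_mono) simp
  also have "\<dots> = A * (2 * t)"
    by (simp add: t_def)
  finally have pz: "\<bar>p \<bullet> z\<bar> \<le> A * (2 * t)" .
  have near': "w - p \<bullet> z \<ge> - (A * t\<^sup>2)" if "t < 1"
    using near that \<rho> by (simp add: t_def power_divide)
  have far': "w \<ge> - A" if "t \<ge> 1"
    using far that \<rho> by (simp add: t_def)
  have ta: "\<rho> powr (- a) * norm z powr a = t powr a"
    using \<rho> by (simp add: t_def powr_divide powr_minus_divide)
  have \<rho>a: "1 \<le> \<rho> powr (- a)"
    using powr_mono'[of "- a" 0 \<rho>] \<rho> c by auto
  show ?thesis
  proof (cases "norm z < 1")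
    case False
    then have "t \<ge> 1"
      using \<rho> by (simp add: t_def)
    \<comment> \<open>Outside the unit ball the correction is cut off and the weight is 1, so
      \<open>\<rho> \<le> 1\<close> alone closes the bound.\<close>
    have "A * 1 \<le> (3 * A) * \<rho> powr (- a)"
      using A \<rho>a by (intro mult_mono) auto
    then show ?thesis
      using far'[OF \<open>t \<ge> 1\<close>] False by (simp add: trunc_powr_def)
  next
    case True
    have rhs: "3 * A * \<rho> powr (- a) * trunc_powr a z = A * (3 * t powr a)"
      using True by (simp add: trunc_powr_def ta[symmetric])
    have ind: "indicat_real (ball 0 1) z = 1"
      using True by simp
    have key: "- (A * (3 * t powr a)) \<le> w - c * (p \<bullet> z)"
    proof (cases "t < 1")
      case True
      show ?thesis
        using c
      proof (elim disjE conjE)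
        assume c: "c = 0" "0 < a" "a \<le> 1"
        have "t \<le> t powr a"
          using powr_mono'[of a 1 t] c t0 True by simp
        moreover have "t\<^sup>2 \<le> t"
          using t0 True by (simp add: power2_eq_square mult_left_le)
        ultimately have "A * (t\<^sup>2 + 2 * t) \<le> A * (3 * t powr a)"
          using A by (intro mult_left_mono) auto
        then show ?thesis
          using near'[OF True] pz c by (simp add: distrib_left)
      next
        assume c: "c = 1" "1 \<le> a" "a \<le> 2"
        have "t powr 2 \<le> t powr a"
          using c t0 True by (intro powr_mono') auto
        moreover have "t powr 2 = t\<^sup>2"
          using t0 by simp
        ultimately have "t\<^sup>2 \<le> 3 * t powr a"
          using powr_ge_zero[of t a] by linarith
        then have "A * t\<^sup>2 \<le> A * (3 * t powr a)"
          using A by (intro mult_left_mono)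
        then show ?thesis
          using near'[OF True] c by simp
      qed
    next
      case False
      then have t1: "t \<ge> 1"
        by simp
      show ?thesis
        using c
      proof (elim disjE conjE)
        assume c: "c = 0" "0 < a" "a \<le> 1"
        have "1 \<le> t powr a"
          using t1 c by (simp add: ge_one_powr_ge_zero)
        then have "A * 1 \<le> A * (3 * t powr a)"
          using A by (intro mult_left_mono) auto
        then show ?thesis
          using far'[OF t1] c by simp
      next
        assume c: "c = 1" "1 \<le> a" "a \<le> 2"
        have "t \<le> t powr a"
          using powr_mono[of 1 a t] c t1 by simp
        then have "A * (1 + 2 * t) \<le> A * (3 * t powr a)"
          using A t1 by (intro mult_left_mono) auto
        then show ?thesis
          using far'[OF t1] pz c by (simp add: distrib_left)
      qed
    qed
    then show ?thesis
      unfolding rhs ind by simp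
  qed
qed

text \<open>The left side bounds \<open>k y0 / u y0 powr \<delta>\<close> from below at the touching
  point \<open>y0\<close>, because \<open>u y0 < h y0 \<le> A\<close>. On the right, the term with
  \<open>Lam\<close> pays for the operator and \<open>2 * B\<close> for the Hamiltonian.\<close>

lemma supersolution_barrier:
  fixes u k H :: "real^'n \<Rightarrow> real"
  assumes s: "0 < s" "s < 1"
    and lam: "0 < lam" "lam \<le> Lam"
    and I: "operator_pos_homogeneous1 s I" "elliptic_Ksym s lam Lam I"
    and H: "\<And>p. H p \<le> B * norm p" "B \<ge> 0"
    and k0: "k0 > 0" "\<And>x. x \<in> \<Omega> \<Longrightarrow> k0 \<le> k x"
    and \<delta>: "\<delta> > 0"
    and u: "viscosity_supersolution s I \<Omega>
              (\<lambda>x t p. indicat_real {1<..<2} (2 * s) * H p - k x / t powr \<delta>) u"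
           "\<And>x. x \<in> \<Omega> \<Longrightarrow> u x > 0" "\<And>x. u x \<ge> 0"
    and a: "2 * s < a" "a \<le> (if 2 * s < 1 then 1 else 2)"
    and \<rho>: "0 < \<rho>" "\<rho> \<le> 1" and cb: "cball x \<rho> \<subseteq> \<Omega>" and A: "u x < A"
  shows "k0 / A powr \<delta> \<le> (3 * Lam * trunc_powr_mass TYPE('n) s a + 2 * B) * A * \<rho> powr (- a)"
proof -
  define m where "m = A / \<rho>\<^sup>2"
  define h where "h = (\<lambda>y. A - m * (norm (y - x))\<^sup>2)"
  have x: "x \<in> \<Omega>"
    using cb \<rho> by auto
  have A0: "A > 0"
    using u(2)[OF x] A by linarith
  have m0: "m > 0"
    using A0 \<rho> by (simp add: m_def)
  \<comment> \<open>Outside the ball the paraboloid lies below \<open>u \<ge> 0\<close>, which later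
    makes the touching from below global.\<close>
  have h_neg: "h y < 0" if "y \<notin> cball x \<rho>" for y
  proof -
    have "\<rho>\<^sup>2 < (norm (y - x))\<^sup>2"
      using that \<rho> by (intro power_strict_mono) (auto simp: dist_norm norm_minus_commute)
    then have "m * \<rho>\<^sup>2 < m * (norm (y - x))\<^sup>2"
      using m0 by simp
    then show ?thesis
      using \<rho> by (simp add: h_def m_def)
  qed
  have "lower_semicontinuous_on (cball x \<rho>) (\<lambda>y. u y - h y)"
    unfolding lower_semicontinuous_on_def
  proof (intro ballI allI impI)
    fix y c assume y: "y \<in> cball x \<rho>" and c: "c < u y - h y"
    define e where "e = (u y - h y - c) / 2"
    have e: "e > 0"
      using c by (simp add: e_def)
    have "lower_semicontinuous_on (closure \<Omega>) u"
      using u(1) unfolding viscosity_supersolution_def by blast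
    moreover have "y \<in> closure \<Omega>"
      using y cb closure_subset by blast
    ultimately have "eventually (\<lambda>z. u y - e < u z) (at y within closure \<Omega>)"
      using e unfolding lower_semicontinuous_on_def by auto
    then have 1: "eventually (\<lambda>z. u y - e < u z) (at y within cball x \<rho>)"
      using cb closure_subset by (blast intro: filter_leD[OF at_le])
    have "(h \<longlongrightarrow> h y) (at y within cball x \<rho>)"
      unfolding h_def by (intro tendsto_intros)
    then have 2: "eventually (\<lambda>z. h z < h y + e) (at y within cball x \<rho>)"
      using e by (intro order_tendstoD(2)) auto
    show "eventually (\<lambda>z. c < u z - h z) (at y within cball x \<rho>)"
      using 1 2 by eventually_elim (simp add: e_def field_simps)
  qed
  then obtain y0 where y0: "y0 \<in> cball x \<rho>" and min: "\<And>y. y \<in> cball x \<rho> \<Longrightarrow> u y0 - h y0 \<le> u y - h y"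
    using lower_semicontinuous_attains_inf[of "cball x \<rho>" "\<lambda>y. u y - h y"] \<rho> by auto
  \<comment> \<open>At the centre \<open>u - h\<close> equals \<open>u x - A < 0\<close>, so its
    minimum is negative too.\<close>
  have neg: "u y0 < h y0"
    using min[of x] A \<rho> by (simp add: h_def)
  have y0\<Omega>: "y0 \<in> \<Omega>"
    using y0 cb by blast
  have "u y0 > 0"
    using u(2) y0\<Omega> by blast
  \<comment> \<open>On the sphere \<open>h\<close> vanishes while \<open>u \<ge> 0\<close>, so a
    negative minimum cannot sit there.\<close>
  have "norm (y0 - x) \<noteq> \<rho>"
    using neg u(3)[of y0] \<rho> by (auto simp: h_def m_def)
  moreover have "norm (y0 - x) \<le> \<rho>"
    using y0 by (simp add: dist_norm norm_minus_commute)
  ultimately have y0_lt: "norm (y0 - x) < \<rho>"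
    by simp
  define r where "r = \<rho> - norm (y0 - x)"
  have r: "0 < r" "r \<le> \<rho>"
    using y0_lt by (auto simp: r_def)
  have sub: "y \<in> cball x \<rho>" if "y \<in> ball y0 r" for y
    using that dist_triangle[of x y y0] by (simp add: r_def dist_norm norm_minus_commute)
  \<comment> \<open>This constant shifts \<open>h\<close> down by the gap
    \<open>h y0 - u y0\<close>, so that \<open>\<phi>\<close> meets \<open>u\<close> at
    \<open>y0\<close>.\<close>
  define c0 where "c0 = u y0 - h y0 + A"
  define \<phi> where "\<phi> = (\<lambda>y. c0 - m * (norm (y - x))\<^sup>2)"
  define v where "v = glue y0 r \<phi> u"
  define p where "p = - (2 * m) *\<^sub>R (y0 - x)"
  have \<phi>h: "\<phi> y = u y0 + (h y - h y0)" for y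
    by (simp add: \<phi>_def c0_def h_def)
  have \<phi>_exp: "\<phi> (y0 + z) - \<phi> y0 - p \<bullet> z = - (m * (norm z)\<^sup>2)" for z
    unfolding \<phi>_def p_def power2_norm_eq_inner
    by (simp add: inner_commute algebra_simps)
  have v_y0: "v y0 = u y0"
    using r by (simp add: v_def glue_def \<phi>h)
  have v_ge: "v y \<ge> \<phi> y" for y
  proof (cases "y \<in> cball x \<rho>")
    case True
    then show ?thesis
      using min[of y] by (auto simp: v_def glue_def \<phi>h)
  next
    case False
    then have "y \<notin> ball y0 r"
      using sub by blast
    then show ?thesis
      using h_neg[OF False] u(3)[of y] neg by (simp add: v_def glue_def \<phi>h)
  qed
  have v_L1: "v \<in> L1_omega s"
    unfolding v_def \<phi>_def using u(1) s(1)
    by (intro glue_quadratic_L1_omega) (simp_all add: viscosity_supersolution_def)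
  have g\<phi>: "GDERIV \<phi> y0 :> p"
    unfolding \<phi>_def p_def by (rule GDERIV_quadratic)
  have "GDERIV v y0 :> p"
    unfolding gderiv_def
    by (rule has_derivative_transform_within_open[OF g\<phi>[unfolded gderiv_def], of "ball y0 r"])
      (use r in \<open>auto simp: v_def glue_def\<close>)
  then have grad_v: "grad v y0 = p"
    by (rule grad_eqI)
  have C11: "C11_at v y0"
    unfolding C11_at_def
  proof (intro exI conjI ballI)
    fix z :: "real^'n" assume "z \<in> ball 0 r"
    then have "v (y0 + z) = \<phi> (y0 + z)" "v y0 = \<phi> y0"
      using r by (auto simp: v_def glue_def dist_norm)
    then show "\<bar>v (y0 + z) - v y0 - p \<bullet> z\<bar> \<le> m * (norm z)\<^sup>2"
      using \<phi>_exp[of z] m0 by simp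
  qed (rule r)
  have p_le: "norm p \<le> 2 * A / \<rho>"
  proof -
    have "norm p = 2 * m * norm (y0 - x)"
      using m0 by (simp add: p_def)
    also have "\<dots> \<le> 2 * m * \<rho>"
      using m0 y0_lt by (intro mult_left_mono) auto
    also have "\<dots> = 2 * A / \<rho>"
      using \<rho> by (simp add: m_def power2_eq_square)
    finally show ?thesis .
  qed
  let ?c = "indicat_real {1..<2} (2 * s)"
  \<comment> \<open>The cap on \<open>a\<close> follows the operator: the gradient correction is
    present from \<open>2 * s = 1\<close> on, exactly where the cap rises from 1 to 2.\<close>
  have c: "?c = 0 \<and> 0 < a \<and> a \<le> 1 \<or> ?c = 1 \<and> 1 \<le> a \<and> a \<le> 2"
    using a s by (auto split: if_splits)
  have "v (y0 + z) - v y0 - ?c * indicat_real (ball 0 1) z * (grad v y0 \<bullet> z)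
      \<ge> - (3 * A * \<rho> powr (- a) * trunc_powr a z)" for z
    unfolding grad_v
  proof (rule barrier_integrand_bound[OF less_imp_le[OF A0] \<rho> p_le c])
    show "- (A / \<rho>\<^sup>2 * (norm z)\<^sup>2) \<le> v (y0 + z) - v y0 - p \<bullet> z"
      using v_ge[of "y0 + z"] \<phi>_exp[of z] v_y0 \<phi>h[of y0] by (simp add: m_def)
    assume "norm z \<ge> \<rho>"
    then have "v (y0 + z) = u (y0 + z)"
      using r by (simp add: v_def glue_def dist_norm)
    moreover have "h y0 \<le> A"
      using m0 by (simp add: h_def)
    ultimately show "- A \<le> v (y0 + z) - v y0"
      using u(3)[of "y0 + z"] neg v_y0 by simp
  qed
  then have Iv: "I v y0 \<ge> - (3 * A * \<rho> powr (- a) * Lam * trunc_powr_mass TYPE('n) s a)"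
    using a A0 s(1) by (intro elliptic_lower_bound[OF I lam _ s(1) a(1) _ v_L1 C11]) (auto split: if_splits)
  have "- I v y0 + (indicat_real {1<..<2} (2 * s) * H (grad \<phi> y0) - k y0 / u y0 powr \<delta>) \<ge> 0"
  proof -
    have "Ck_on 2 (ball y0 r) \<phi>"
      unfolding \<phi>_def by (rule Ck_on_2_quadratic)
    moreover have "u y0 = \<phi> y0"
      by (simp add: \<phi>h)
    moreover have "\<forall>y\<in>ball y0 r. u y \<ge> \<phi> y"
      using min sub by (fastforce simp: \<phi>h)
    ultimately show ?thesis
      using u(1) y0\<Omega> r(1) v_L1 unfolding viscosity_supersolution_def v_def by blast
  qed
  then have sol: "k y0 / u y0 powr \<delta> \<le> indicat_real {1<..<2} (2 * s) * H p - I v y0"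
    using grad_eqI[OF g\<phi>] by simp
  \<comment> \<open>The Hamiltonian appears only for \<open>2 * s > 1\<close>; then
    \<open>a > 1\<close>, and \<open>\<rho> \<le> 1\<close> lets the order
    \<open>\<rho> powr (- 1)\<close> be absorbed.\<close>
  have Hp: "indicat_real {1<..<2} (2 * s) * H p \<le> 2 * B * A * \<rho> powr (- a)"
  proof (cases "2 * s \<in> {1<..<2}")
    case True
    have "H p \<le> B * norm p"
      by (rule H)
    also have "\<dots> \<le> B * (2 * A / \<rho>)"
      using p_le H(2) by (rule mult_left_mono)
    also have "\<dots> = 2 * B * A * \<rho> powr (- 1)"
      using \<rho> by (simp add: powr_minus_divide)
    also have "\<dots> \<le> 2 * B * A * \<rho> powr (- a)"
      using \<rho> True a A0 H(2) by (intro mult_left_mono powr_mono') auto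
    finally show ?thesis
      using True by simp
  next
    case False
    then show ?thesis
      using A0 H(2) by simp
  qed
  have "h y0 \<le> A"
    using m0 by (simp add: h_def)
  then have "u y0 powr \<delta> \<le> A powr \<delta>"
    using neg \<open>u y0 > 0\<close> \<delta> by (intro powr_mono2) auto
  then have "k0 / A powr \<delta> \<le> k y0 / u y0 powr \<delta>"
    using k0(1) k0(2)[OF y0\<Omega>] \<open>u y0 > 0\<close> by (intro frac_le) auto
  then show ?thesis
    using sol Hp Iv by (simp add: algebra_simps)
qed

section \<open>Growth of supersolutions away from the boundary\<close>

text \<open>With \<open>A = 2 * u x\<close> and \<open>\<rho>\<close> proportional to the distance,
  the barrier inequality reads \<open>k0 / C0 * \<rho> powr a \<le> A powr (1 + \<delta>)\<close>;
  taking the root of order \<open>1 + \<delta>\<close> gives the exponent.\<close>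

lemma supersolution_growth:
  fixes u k H :: "real^'n \<Rightarrow> real"
  assumes s: "0 < s" "s < 1"
    and lam: "0 < lam" "lam \<le> Lam"
    and \<Omega>: "open \<Omega>" "bounded \<Omega>"
    and I: "operator_pos_homogeneous1 s I" "elliptic_Ksym s lam Lam I"
    and H: "pos_homogeneous1 H" "locally_lipschitz H"
    and k: "continuous_on (closure \<Omega>) k" "\<And>x. x \<in> closure \<Omega> \<Longrightarrow> k x > 0"
    and \<delta>: "\<delta> > 0"
    and u: "viscosity_supersolution s I \<Omega>
              (\<lambda>x t p. indicat_real {1<..<2} (2 * s) * H p - k x / t powr \<delta>) u"
           "\<And>x. x \<in> \<Omega> \<Longrightarrow> u x > 0" "\<And>x. u x \<ge> 0"
    and a: "2 * s < a" "a \<le> (if 2 * s < 1 then 1 else 2)"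
  shows "\<exists>c>0. \<forall>x\<in>\<Omega>. c * infdist x (- \<Omega>) powr (a / (1 + \<delta>)) \<le> u x"
proof (cases "\<Omega> = {}")
  case True
  then show ?thesis
    by (intro exI[of _ 1]) auto
next
  case False
  obtain B where B: "B \<ge> 0" "\<And>p. H p \<le> B * norm p"
    using pos_homogeneous1_bound[OF H] by blast
  have "compact (closure \<Omega>)" "closure \<Omega> \<noteq> {}"
    using \<Omega> False by (auto simp: compact_closure)
  then obtain y where y: "y \<in> closure \<Omega>" "\<And>x. x \<in> closure \<Omega> \<Longrightarrow> k y \<le> k x"
    using continuous_attains_inf[OF _ _ k(1)] by blast
  define k0 where "k0 = k y"
  have k0: "k0 > 0" "\<And>x. x \<in> \<Omega> \<Longrightarrow> k0 \<le> k x"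
    using y k closure_subset[of \<Omega>] by (auto simp: k0_def)
  obtain b where b: "b \<in> - \<Omega>"
    using \<Omega>(2) not_bounded_UNIV[where 'a="real^'n"] by (metis ComplI UNIV_eq_I)
  obtain R0 where R0: "\<And>x. x \<in> \<Omega> \<Longrightarrow> dist b x \<le> R0"
    using \<Omega>(2) unfolding bounded_any_center[of \<Omega> b] by blast
  \<comment> \<open>Since \<open>R\<close> is at least 1 and bounds the distance,
    \<open>d / (2 * R)\<close> is both at most 1 and less than \<open>d\<close>.\<close>
  define R where "R = max 1 R0"
  have R: "R \<ge> 1" "R > 0" "\<And>x. x \<in> \<Omega> \<Longrightarrow> infdist x (- \<Omega>) \<le> R"
    using R0 infdist_le2[OF b] by (fastforce simp: R_def dist_commute le_max_iff_disj)+
  define C0 where "C0 = 3 * Lam * trunc_powr_mass TYPE('n) s a + 2 * B + 1"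
  have C0: "C0 > 0"
    unfolding C0_def using lam B(1)
    by (intro add_nonneg_pos add_nonneg_nonneg mult_nonneg_nonneg trunc_powr_mass_nonneg) auto
  \<comment> \<open>The inner power comes from \<open>\<rho> = d / (2 * R)\<close>, the final
    halving from \<open>A = 2 * u x\<close>.\<close>
  define c where "c = (k0 / C0 * (1 / (2 * R)) powr a) powr (1 / (1 + \<delta>)) / 2"
  have c: "c > 0"
    using k0 C0 R by (simp add: c_def)
  have "c * infdist x (- \<Omega>) powr (a / (1 + \<delta>)) \<le> u x" if x: "x \<in> \<Omega>" for x
  proof -
    define d where "d = infdist x (- \<Omega>)"
    define A where "A = 2 * u x"
    define \<rho> where "\<rho> = d / (2 * R)"
    have ux: "u x > 0"
      using u(2) x by blast
    have d: "d > 0"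
      unfolding d_def using x b \<Omega>(1) by (intro infdist_pos_not_in_closed) (auto simp: closed_Compl)
    have \<rho>: "0 < \<rho>" "\<rho> \<le> 1" "\<rho> < d"
      using d R(1) R(3)[OF x] by (auto simp: \<rho>_def d_def[symmetric] divide_le_eq divide_less_eq)
    have "cball x \<rho> \<subseteq> \<Omega>"
    proof
      fix y assume y: "y \<in> cball x \<rho>"
      show "y \<in> \<Omega>"
      proof (rule ccontr)
        assume "y \<notin> \<Omega>"
        then have "d \<le> dist x y"
          unfolding d_def by (intro infdist_le) auto
        then show False
          using y \<rho>(3) by simp
      qed
    qed
    then have "k0 / A powr \<delta> \<le> (3 * Lam * trunc_powr_mass TYPE('n) s a + 2 * B) * A * \<rho> powr (- a)"
      using ux by (intro supersolution_barrier[OF s lam I B(2,1) k0 \<delta> u a \<rho>(1,2)]) (auto simp: A_def)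
    also have "\<dots> \<le> C0 * A * \<rho> powr (- a)"
      using ux by (intro mult_right_mono) (auto simp: C0_def A_def)
    finally have "k0 \<le> C0 * A * \<rho> powr (- a) * A powr \<delta>"
      using ux by (simp add: A_def divide_le_eq)
    also have "\<dots> = C0 * A powr (1 + \<delta>) / \<rho> powr a"
      using ux by (simp add: A_def powr_add powr_minus_divide)
    finally have "k0 / C0 * \<rho> powr a \<le> A powr (1 + \<delta>)"
      using C0 \<rho>(1) by (simp add: field_simps)
    then have "(k0 / C0 * \<rho> powr a) powr (1 / (1 + \<delta>)) \<le> (A powr (1 + \<delta>)) powr (1 / (1 + \<delta>))"
      using \<delta> k0 C0 by (intro powr_mono2) auto
    also have "\<dots> = A"
      using ux \<delta> by (simp add: powr_powr A_def)
    also have "k0 / C0 * \<rho> powr a = k0 / C0 * (1 / (2 * R)) powr a * d powr a"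
      using d R(2) by (simp add: \<rho>_def powr_divide)
    also have "(k0 / C0 * (1 / (2 * R)) powr a * d powr a) powr (1 / (1 + \<delta>))
        = 2 * c * d powr (a / (1 + \<delta>))"
      using k0 C0 R(2) by (subst powr_mult) (simp_all add: c_def powr_powr)
    finally show ?thesis
      by (simp add: A_def d_def)
  qed
  with c show ?thesis
    by blast
qed

section \<open>Comparison with the distance, blow-up of the ratio, failure of Hoelder
  regularity\<close>

theorem theorem4p2:
  fixes s lam Lam \<delta> \<beta> C :: real
    and \<Omega> :: "(real^'n) set"
    and I :: "(real^'n \<Rightarrow> real) \<Rightarrow> real^'n \<Rightarrow> real"
    and H k u \<psi> :: "real^'n \<Rightarrow> real"
  assumes s: "0 < s" "s < 1"
    and lam: "0 < lam" "lam \<le> Lam"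
    and dom: "smooth_bounded_domain \<Omega>"
    and I: "translation_invariant s I" "operator_pos_homogeneous1 s I" "elliptic_Ksym s lam Lam I"
    and H: "pos_homogeneous1 H" "locally_lipschitz H"
    and k: "continuous_on (closure \<Omega>) k" "\<forall>x\<in>closure \<Omega>. k x > 0"
    and \<delta>: "\<delta> > 0"
    and u: "viscosity_solution s I \<Omega>
              (\<lambda>x t p. indicat_real {1<..<2} (2 * s) * H p - k x / t powr \<delta>) u"
           "\<forall>x\<in>\<Omega>. u x > 0" "\<forall>x\<in>- \<Omega>. u x = 0"
    and \<psi>: "viscosity_solution s I \<Omega>
              (\<lambda>x t p. indicat_real {1<..<2} (2 * s) * H p - 1) \<psi>"
           "\<forall>x\<in>\<Omega>. \<psi> x > 0" "\<forall>x\<in>- \<Omega>. \<psi> x = 0"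
    and \<beta>: "0 < \<beta>" "\<beta> < min 1 (2 * s)"
    and C: "\<forall>x\<in>\<Omega>. infdist x (- \<Omega>) powr \<beta> \<le> C * \<psi> x"
    and \<beta>\<delta>: "\<beta> * (1 + \<delta>) > 2 * s"
  shows "(\<exists>C1. \<forall>x\<in>\<Omega>. infdist x (- \<Omega>) powr \<beta> \<le> C1 * u x) \<and>
         (SUP x\<in>\<Omega>. ereal (u x / infdist x (- \<Omega>) powr \<beta>)) = \<infinity> \<and>
         \<not> holder_on \<beta> (closure \<Omega>) u"
proof -
  have \<Omega>: "open \<Omega>" "bounded \<Omega>" "\<Omega> \<noteq> {}"
    using dom unfolding smooth_bounded_domain_def by auto
  \<comment> \<open>The midpoint between \<open>2 * s\<close> and the smaller of two upper limits,
    both of which exceed \<open>2 * s\<close>.\<close>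
  define a where "a = (2 * s + min (\<beta> * (1 + \<delta>)) (if 2 * s < 1 then 1 else 2)) / 2"
  have a: "2 * s < a" "a \<le> (if 2 * s < 1 then 1 else 2)" "a < \<beta> * (1 + \<delta>)"
    using \<beta>\<delta> s by (auto simp: a_def min_def)
  define \<gamma> where "\<gamma> = a / (1 + \<delta>)"
  have \<gamma>: "\<gamma> < \<beta>"
    using a(3) \<delta> by (simp add: \<gamma>_def divide_less_eq)
  let ?d = "\<lambda>x. infdist x (- \<Omega>)"
  have u0: "u x \<ge> 0" for x
    using u(2,3) by (cases "x \<in> \<Omega>") (auto intro: less_imp_le)
  have sup: "viscosity_supersolution s I \<Omega>
      (\<lambda>x t p. indicat_real {1<..<2} (2 * s) * H p - k x / t powr \<delta>) u"
    using u(1) unfolding viscosity_solution_def by simp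
  have "\<exists>c>0. \<forall>x\<in>\<Omega>. c * ?d x powr \<gamma> \<le> u x"
    unfolding \<gamma>_def
    by (rule supersolution_growth[OF s lam \<Omega>(1,2) I(2,3) H k(1) _ \<delta> sup _ u0 a(1,2)])
      (use k(2) u(2) in auto)
  then obtain c where c: "c > 0" "\<And>x. x \<in> \<Omega> \<Longrightarrow> c * ?d x powr \<gamma> \<le> u x"
    by auto
  have "\<Omega> \<noteq> UNIV"
    using \<Omega>(2) not_bounded_UNIV by metis
  then have compl: "- \<Omega> \<noteq> {}" "closed (- \<Omega>)"
    using \<Omega>(1) by (blast, simp add: closed_Compl)
  have d_pos: "?d x > 0" if "x \<in> \<Omega>" for x
    using that compl by (intro infdist_pos_not_in_closed) auto
  obtain b where b: "b \<in> - \<Omega>"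
    using compl by blast
  obtain R where R: "\<And>x. x \<in> \<Omega> \<Longrightarrow> dist b x \<le> R"
    using \<Omega>(2) unfolding bounded_any_center[of \<Omega> b] by blast
  have dR: "?d x \<le> R" if "x \<in> \<Omega>" for x
    using R[OF that] infdist_le2[OF b] by (simp add: dist_commute)
  \<comment> \<open>The surplus power of the distance is bounded because the domain is.\<close>
  have "?d x powr \<beta> \<le> R powr (\<beta> - \<gamma>) / c * u x" if x: "x \<in> \<Omega>" for x
  proof -
    have "?d x powr \<beta> = ?d x powr (\<beta> - \<gamma>) * ?d x powr \<gamma>"
      by (simp add: powr_add[symmetric])
    also have "\<dots> \<le> R powr (\<beta> - \<gamma>) * (u x / c)"
      using c(2)[OF x] c(1) dR[OF x] d_pos[OF x] \<gamma>
      by (intro mult_mono powr_mono2) (auto simp: field_simps)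
    finally show ?thesis
      by simp
  qed
  then have part1: "\<exists>C1. \<forall>x\<in>\<Omega>. ?d x powr \<beta> \<le> C1 * u x"
    by blast
  \<comment> \<open>The ratio of \<open>u\<close> to the \<open>\<beta>\<close>-th power of the
    distance is at least \<open>c * ?d x powr (\<gamma> - \<beta>)\<close>, which blows up at the
    boundary. Here \<open>e\<close> is the distance at which this lower bound equals
    \<open>M'\<close>.\<close>
  have unbdd: "\<exists>x\<in>\<Omega>. M * ?d x powr \<beta> < u x" for M
  proof -
    define M' where "M' = max M 1"
    define e where "e = (c / M') powr (1 / (\<beta> - \<gamma>))"
    have M': "M' > 0" "M \<le> M'"
      by (auto simp: M'_def)
    have e: "e > 0"
      using c(1) M' by (simp add: e_def)
    have "frontier \<Omega> \<noteq> {}"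
      using \<Omega> compl frontier_eq_empty by blast
    then obtain y where y: "y \<in> closure \<Omega>" "y \<notin> \<Omega>"
      using \<Omega>(1) by (auto simp: frontier_def interior_open)
    then obtain x where x: "x \<in> \<Omega>" "dist x y < e"
      using e unfolding closure_approachable by blast
    have "?d x < e"
      using infdist_le[of y "- \<Omega>" x] x y by simp
    then have "?d x powr (\<beta> - \<gamma>) < e powr (\<beta> - \<gamma>)"
      using d_pos[OF x(1)] \<gamma> by (intro powr_less_mono2) auto
    also have "\<dots> = c / M'"
      using c(1) M' \<gamma> by (simp add: e_def powr_powr)
    finally have "M' * ?d x powr (\<beta> - \<gamma>) < c"
      using M' by (simp add: field_simps)
    then have "M' * ?d x powr (\<beta> - \<gamma>) * ?d x powr \<gamma> < c * ?d x powr \<gamma>"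
      using d_pos[OF x(1)] by simp
    then have "M' * ?d x powr \<beta> < c * ?d x powr \<gamma>"
      by (simp add: mult.assoc powr_add[symmetric])
    moreover have "M * ?d x powr \<beta> \<le> M' * ?d x powr \<beta>"
      using M' by (intro mult_right_mono) auto
    ultimately show ?thesis
      using x c(2) by (intro bexI[of _ x]) fastforce+
  qed
  have part2: "(SUP x\<in>\<Omega>. ereal (u x / ?d x powr \<beta>)) = \<infinity>"
  proof (rule SUP_PInfty)
    fix n :: nat
    obtain x where x: "x \<in> \<Omega>" "real n * ?d x powr \<beta> < u x"
      using unbdd by blast
    have "?d x powr \<beta> > 0"
      using d_pos[OF x(1)] by simp
    then have "real n \<le> u x / ?d x powr \<beta>"
      using x(2) by (simp add: pos_le_divide_eq del: powr_gt_zero)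
    then show "\<exists>x\<in>\<Omega>. ereal (real n) \<le> ereal (u x / ?d x powr \<beta>)"
      using x(1) by auto
  qed
  have part3: "\<not> holder_on \<beta> (closure \<Omega>) u"
  proof
    assume "holder_on \<beta> (closure \<Omega>) u"
    then obtain M where M: "\<And>x y. x \<in> closure \<Omega> \<Longrightarrow> y \<in> closure \<Omega> \<Longrightarrow> \<bar>u x - u y\<bar> \<le> M * dist x y powr \<beta>"
      unfolding holder_on_def by blast
    obtain x where x: "x \<in> \<Omega>" "M * ?d x powr \<beta> < u x"
      using unbdd by blast
    obtain y where y: "y \<in> - \<Omega>" "?d x = dist x y"
      by (rule infdist_attains_inf[OF compl(2,1)])
    \<comment> \<open>The nearest complement point \<open>y\<close> lies in the closure of this
      ball, hence in \<open>closure \<Omega>\<close>. As \<open>u y = 0\<close>, the Hoelder bound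
      between \<open>x\<close> and \<open>y\<close> would cap \<open>u x\<close> and contradict the
      choice of \<open>x\<close>.\<close>
    have "ball x (?d x) \<subseteq> \<Omega>"
    proof
      fix z assume z: "z \<in> ball x (?d x)"
      show "z \<in> \<Omega>"
        using z infdist_le[of z "- \<Omega>" x] by (cases "z \<in> \<Omega>") auto
    qed
    then have "closure (ball x (?d x)) \<subseteq> closure \<Omega>"
      by (rule closure_mono)
    then have "cball x (?d x) \<subseteq> closure \<Omega>"
      by (simp only: closure_ball[OF d_pos[OF x(1)]])
    moreover have "y \<in> cball x (?d x)"
      by (simp add: y(2))
    ultimately have "y \<in> closure \<Omega>"
      by (rule subsetD)
    moreover have "x \<in> closure \<Omega>"
      using x(1) closure_subset by (rule rev_subsetD)
    ultimately have "\<bar>u x - u y\<bar> \<le> M * ?d x powr \<beta>"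
      using M[of x y] by (simp only: y(2))
    moreover have "u y = 0"
      using u(3) y(1) by (rule bspec)
    ultimately show False
      using x(2) by simp
  qed
  show ?thesis
    using part1 part2 part3 by blast
qed

end
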